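(* Let $I\subseteq\mathbb{R}$ be an open interval, let $f,g:I\to\mathbb{R}$ be infinitely differentiable, and let $a(x)=f(x)g(x)$. For integers $n,k\ge 0$ and $x\in I$, let $F(n,k,x)$ denote the coefficient of $z^n$ in $[f(x+z)]^k$ and let $G(n,k,x)$ denote the coefficient of $z^n$ in $[g(x+z)]^k$. Then the composita $Y^{\Delta}(n,k,x)$ of the generating function $Y(x,z)=f(x+z)g(x+z)-f(x)g(x)$ is, for all integers $n\ge k\ge 1$ and all $x\in I$, $$Y^{\Delta}(n,k,x)=\sum_{j=0}^{k}\binom{k}{j}\left(\sum_{i=0}^{n}F(i,j,x)\,G(n-i,j,x)\right)[f(x)g(x)]^{k-j}(-1)^{k-j}.$$
   Context: For an infinitely differentiable function $h$, the expression $h(x+z)$ denotes the formal power series $\sum_{n\ge 0}\frac{h^{(n)}(x)}{n!}z^n$ in $z$, and $h(x+z)-h(x)=\sum_{n\ge 1}\frac{h^{(n)}(x)}{n!}z^n$. The composita of the generating function $h(x+z)-h(x)$ is the array $$H^{\Delta}(n,k,x)=\sum_{\substack{\lambda_1+\cdots+\lambda_k=n\\ \lambda_1,\dots,\lambda_k\ge 1}}\frac{h^{(\lambda_1)}(x)}{\lambda_1!}\cdots\frac{h^{(\lambda_k)}(x)}{\lambda_k!},\qquad n\ge k\ge 1,$$ the sum being over all compositions of $n$ into exactly $k$ positive parts; equivalently, $[h(x+z)-h(x)]^k=\sum_{n\ge k}H^{\Delta}(n,k,x)z^n$. In the claim, $Y^{\Delta}$ is this array for $h=a=fg$. The convention is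 that a zeroth power equals $1$ (so $[f(x+z)]^0=[g(x+z)]^0=1$ and $[f(x)g(x)]^0=1$). *)

theory Defs
  imports "HOL-Analysis.Analysis" "HOL-Computational_Algebra.Formal_Power_Series"
begin

(* Intended for open S only: functions S \<rightarrow> \<real> are represented by total functions on \<real>, and
   deriv is the two-sided derivative, so at points of an open S the iterated derivatives
   depend only on the values on S. *)
definition infinitely_differentiable_on :: "(real \<Rightarrow> real) \<Rightarrow> real set \<Rightarrow> bool"
  where "infinitely_differentiable_on h S \<longleftrightarrow>
    (\<forall>n. \<forall>x\<in>S. (deriv ^^ n) h field_differentiable at x)"

(* h(x + z) as a formal power series in z; no convergence to h is claimed. *)
definition shift_fps :: "(real \<Rightarrow> real) \<Rightarrow> real \<Rightarrow> real fps"
  where "shift_fps h x = Abs_fps (\<lambda>n. (deriv ^^ n) h x / fact n)"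

definition compositions :: "nat \<Rightarrow> nat \<Rightarrow> nat list set"
  where "compositions n k =
    {ls. length ls = k \<and> sum_list ls = n \<and> (\<forall>l\<in>set ls. l \<ge> 1)}"

(* The array H^Delta(n,k,x), i.e. the composita of the generating function h(x + z) - h(x). *)
definition composita :: "(real \<Rightarrow> real) \<Rightarrow> nat \<Rightarrow> nat \<Rightarrow> real \<Rightarrow> real"
  where "composita h n k x =
    (\<Sum>ls\<in>compositions n k. \<Prod>i<k. (deriv ^^ (ls ! i)) h x / fact (ls ! i))"

definition shift_power_coeff :: "(real \<Rightarrow> real) \<Rightarrow> nat \<Rightarrow> nat \<Rightarrow> real \<Rightarrow> real"
  where "shift_power_coeff h n k x = fps_nth (shift_fps h x ^ k) n"

lemma finite_compositions: "finite (compositions n k)"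
proof (rule finite_subset)
  show "compositions n k \<subseteq> {ls. set ls \<subseteq> {..n} \<and> length ls = k}"
    by (auto simp: compositions_def dest: member_le_sum_list)
  show "finite {ls. set ls \<subseteq> {..n} \<and> length ls = k}"
    by (rule finite_lists_length_eq) simp
qed

end

theory Submission
  imports Defs
begin

text \<open>
  By the Leibniz rule the Taylor series of a product is the product of the Taylor series, so
  \<open>Y\<close> is \<open>f(x+z) g(x+z)\<close> minus its constant term. The composita of a series without constant
  term lists the coefficients of its powers, and the powers of \<open>Y\<close> are expanded by the
  binomial theorem.
\<close>

lemma higher_deriv_has_field_derivative:
  assumes "infinitely_differentiable_on h S" and "x \<in> S"
  shows "((deriv ^^ n) h has_field_derivative (deriv ^^ Suc n) h x) (at x)"
  using assms by (simp add: infinitely_differentiable_on_def DERIV_deriv_iff_field_differentiable)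

text \<open>In \<open>h(x + z)\<close> the base point and the formal variable enter only through
  their sum, so differentiating in either gives the same series; both sides are
  \<open>(deriv ^^ Suc n) h x / fact n\<close>.\<close>

lemma shift_fps_nth_has_field_derivative:
  assumes "infinitely_differentiable_on h S" and "x \<in> S"
  shows "((\<lambda>t. fps_nth (shift_fps h t) n) has_field_derivative
    fps_nth (fps_deriv (shift_fps h x)) n) (at x)"
proof -
  have "fps_nth (fps_deriv (shift_fps h x)) n = (deriv ^^ Suc n) h x / fact n"
    by (simp add: shift_fps_def divide_simps del: of_nat_Suc)
  then show ?thesis
    using DERIV_cdivide[OF higher_deriv_has_field_derivative[OF assms, of n], of "fact n"]
    by (simp add: shift_fps_def del: fps_deriv_nth)
qed

text \<open>The Leibniz rule in coefficient form. The induction moves the base point: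
  differentiating coefficient \<open>n\<close> there yields a coefficient of
  \<open>fps_deriv\<close>, hence coefficient \<open>Suc n\<close>.\<close>

lemma shift_fps_mult_nth:
  assumes "open S" and f: "infinitely_differentiable_on f S"
    and g: "infinitely_differentiable_on g S" and "x \<in> S"
  shows "fps_nth (shift_fps (\<lambda>t. f t * g t) x) n = fps_nth (shift_fps f x * shift_fps g x) n"
  using \<open>x \<in> S\<close>
proof (induction n arbitrary: x)
  case 0
  then show ?case by (simp add: shift_fps_def)
next
  case (Suc n)
  let ?a = "\<lambda>t. f t * g t"
  let ?P = "\<lambda>t. shift_fps f t * shift_fps g t"
  \<comment> \<open>The analytic product rule, applied to each term of the Cauchy product, matches
    the formal one in \<open>fps_deriv_mult\<close>.\<close>
  have "((\<lambda>t. fps_nth (?P t) n) has_field_derivative fps_nth (fps_deriv (?P x)) n) (at x)"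
    unfolding fps_mult_nth fps_deriv_mult fps_add_nth sum.distrib[symmetric]
    by (rule DERIV_sum) (auto intro!: derivative_eq_intros
        shift_fps_nth_has_field_derivative[OF f Suc.prems]
        shift_fps_nth_has_field_derivative[OF g Suc.prems] simp: algebra_simps simp del: fps_deriv_nth)
  then have "((\<lambda>t. fact n * fps_nth (?P t) n) has_field_derivative
      fact n * fps_nth (fps_deriv (?P x)) n) (at x)"
    by (rule DERIV_cmult)
  \<comment> \<open>The induction hypothesis is used on all of the open set \<open>S\<close>, since
    a derivative at \<open>x\<close> needs equality near \<open>x\<close>.\<close>
  moreover have "fact n * fps_nth (?P t) n = (deriv ^^ n) ?a t" if "t \<in> S" for t
    using Suc.IH[OF that] by (simp add: shift_fps_def field_simps)
  ultimately have "((deriv ^^ n) ?a has_field_derivative fact n * fps_nth (fps_deriv (?P x)) n) (at x)"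
    using has_field_derivative_transform_within_open \<open>open S\<close> Suc.prems by blast
  then have "(deriv ^^ Suc n) ?a x = fact n * fps_nth (fps_deriv (?P x)) n"
    by (simp add: DERIV_imp_deriv)
  also have "\<dots> = fact (Suc n) * fps_nth (?P x) (Suc n)"
    by (simp only: fps_deriv_nth Suc_eq_plus1[symmetric] fact_Suc mult_ac)
  finally have "(deriv ^^ Suc n) ?a x / fact (Suc n) = fps_nth (?P x) (Suc n)"
    by (simp only: nonzero_mult_div_cancel_left[OF fact_nonzero])
  then show ?case
    by (simp only: shift_fps_def fps_nth_Abs_fps)
qed

lemma shift_fps_mult:
  assumes "open S" and "infinitely_differentiable_on f S"
    and "infinitely_differentiable_on g S" and "x \<in> S"
  shows "shift_fps (\<lambda>t. f t * g t) x = shift_fps f x * shift_fps g x"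
  using shift_fps_mult_nth[OF assms] by (intro fps_ext)

text \<open>Expanding the power sums over \<open>natpermute n k\<close>, where zero parts are
  allowed; each zero part contributes the vanishing constant term as a factor.\<close>

lemma composita_eq_fps_nth_power:
  assumes "1 \<le> k"
  shows "composita h n k x = fps_nth ((shift_fps h x - fps_const (h x)) ^ k) n"
proof -
  let ?Y = "shift_fps h x - fps_const (h x)"
  have Y0: "fps_nth ?Y 0 = 0"
    by (simp add: shift_fps_def)
  have Yl: "fps_nth ?Y l = (deriv ^^ l) h x / fact l" if "l \<ge> 1" for l
    using that by (simp add: shift_fps_def)
  have "composita h n k x = (\<Sum>ls\<in>compositions n k. \<Prod>i<k. fps_nth ?Y (ls ! i))"
    unfolding composita_def
    by (intro sum.cong prod.cong refl Yl[symmetric]) (auto simp: compositions_def)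
  also have "\<dots> = (\<Sum>ls\<in>natpermute n k. \<Prod>i<k. fps_nth ?Y (ls ! i))"
  proof (rule sum.mono_neutral_left)
    show "finite (natpermute n k)" by (rule natpermute_finite)
    show "compositions n k \<subseteq> natpermute n k"
      by (auto simp: compositions_def natpermute_def)
    show "\<forall>ls\<in>natpermute n k - compositions n k. (\<Prod>i<k. fps_nth ?Y (ls ! i)) = 0"
    proof
      fix ls assume "ls \<in> natpermute n k - compositions n k"
      then obtain i where "i < k" "ls ! i = 0"
        by (auto simp: compositions_def natpermute_def in_set_conv_nth)
      then show "(\<Prod>i<k. fps_nth ?Y (ls ! i)) = 0"
        using Y0 by (intro prod_zero bexI[of _ i]) simp_all
    qed
  qed
  also have "\<dots> = fps_nth (?Y ^ k) n"
  proof -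
    \<comment> \<open>Fails at \<open>k = 0\<close>, where truncated subtraction makes the right
      side \<open>{0}\<close>.\<close>
    have "{..<k} = {0..k - 1}" using assms by auto
    then show ?thesis using assms by (simp only: fps_power_nth) simp
  qed
  finally show ?thesis .
qed

theorem theorem3p4:
  fixes I :: "real set" and f g :: "real \<Rightarrow> real" and n k :: nat and x :: real
  assumes "open I" and "is_interval I"
    and "infinitely_differentiable_on f I" and "infinitely_differentiable_on g I"
    and "1 \<le> k" and "k \<le> n" and "x \<in> I"
  shows "composita (\<lambda>t. f t * g t) n k x =
    (\<Sum>j=0..k. of_nat (k choose j) *
      (\<Sum>i=0..n. shift_power_coeff f i j x * shift_power_coeff g (n - i) j x) *
      (f x * g x) ^ (k - j) * (-1) ^ (k - j))"
proof -
  let ?F = "shift_fps f x" and ?G = "shift_fps g x" and ?c = "f x * g x"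
  have "composita (\<lambda>t. f t * g t) n k x = fps_nth ((?F * ?G + fps_const (- ?c)) ^ k) n"
    using assms by (simp add: composita_eq_fps_nth_power shift_fps_mult flip: fps_const_neg)
  also have "\<dots> = (\<Sum>j=0..k. of_nat (k choose j) * fps_nth ((?F * ?G) ^ j) n * (- ?c) ^ (k - j))"
    by (simp add: binomial_ring fps_sum_nth fps_of_nat[symmetric] fps_const_power atLeast0AtMost
        mult.assoc del: fps_const_neg)
  \<comment> \<open>The inner sum is the Cauchy product of \<open>?F ^ j\<close> and
    \<open>?G ^ j\<close>; the sign is split off \<open>(- ?c) ^ (k - j)\<close>.\<close>
  also have "\<dots> = (\<Sum>j=0..k. of_nat (k choose j) *
      (\<Sum>i=0..n. shift_power_coeff f i j x * shift_power_coeff g (n - i) j x) *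
      ?c ^ (k - j) * (-1) ^ (k - j))"
    by (intro sum.cong refl)
      (simp add: power_mult_distrib[of ?F] fps_mult_nth shift_power_coeff_def
        power_minus[of ?c] mult.assoc mult.commute[of "(-1) ^ _"])
  finally show ?thesis .
qed

end
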